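(* Let $N\ge1$, $T>0$ and $\delta>0$. Let $a,b\in\mathbb R^N$ satisfy $|a-b|>2\delta$ and let $0<\varepsilon<\delta$. Then no continuous autonomous semiflow $(\Psi^t)_{t\ge0}$ on $\mathbb R^N$ can satisfy both $$\Psi^T(\overline{\mathrm B}_\delta(a))\subset \mathrm B_\varepsilon(b)\qquad\text{and}\qquad \Psi^T(\overline{\mathrm B}_\delta(b))\subset \mathrm B_\varepsilon(a).$$
   Context: $\mathrm B_r(x)$ is the open Euclidean ball of radius $r$ about $x$ in $\mathbb R^N$ and $\overline{\mathrm B}_r(x)$ its closure. A continuous autonomous semiflow on $\mathbb R^N$ is a family $(\Psi^t)_{t\ge0}$ of maps $\Psi^t:\mathbb R^N\to\mathbb R^N$ such that $(t,x)\mapsto\Psi^t(x)$ is continuous on $[0,\infty)\times\mathbb R^N$, $\Psi^0=\mathrm{Id}$, and $\Psi^{t+s}=\Psi^t\circ\Psi^s$ for all $s,t\ge0$. *)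

theory Defs
  imports "HOL-Analysis.Analysis"
begin

text \<open>The time parameter of a semiflow ranges over \<open>[0,\<infinity>)\<close>; the type of time is \<^typ>\<open>real\<close>, and
  the values at negative times are unconstrained.\<close>

definition continuous_semiflow :: "(real \<Rightarrow> 'a::topological_space \<Rightarrow> 'a) \<Rightarrow> bool" where
  "continuous_semiflow \<Psi> \<longleftrightarrow>
     continuous_on ({0..} \<times> UNIV) (\<lambda>(t, x). \<Psi> t x) \<and>
     \<Psi> 0 = id \<and>
     (\<forall>s\<ge>0. \<forall>t\<ge>0. \<Psi> (t + s) = \<Psi> t \<circ> \<Psi> s)"

end

theory Submission
  imports Defs
begin

text \<open>Brouwer's theorem gives a fixed point \<open>p\<close> of \<open>\<Psi>\<^bsup>2T\<^esup>\<close> in the closed ball about \<open>a\<close>. Every point of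
  the orbit of \<open>p\<close> is again fixed by \<open>\<Psi>\<^bsup>2T\<^esup>\<close>, so as soon as it lies in the closed \<open>\<delta>\<close>-ball about \<open>a\<close> it
  lies in the open \<open>\<epsilon>\<close>-ball. The orbit is connected, hence never leaves the \<open>\<epsilon>\<close>-ball, although at time
  \<open>T\<close> it is near \<open>b\<close>.\<close>

lemma continuous_semiflow_continuous_map:
  assumes "continuous_semiflow \<Psi>" and "t \<ge> 0"
  shows "continuous_on S (\<Psi> t)"
proof -
  have "continuous_on ({0..} \<times> UNIV) (\<lambda>(t, x). \<Psi> t x)"
    using assms(1) by (simp add: continuous_semiflow_def)
  \<comment> \<open>The redundant \<open>case\<close> displays the map as the uncurried flow after
    \<open>x \<mapsto> (t, x)\<close>, the shape that \<open>continuous_on_compose2\<close>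
    matches.\<close>
  then have "continuous_on S (\<lambda>x. case (t, x) of (t, x) \<Rightarrow> \<Psi> t x)"
    by (rule continuous_on_compose2) (use assms(2) in \<open>auto intro!: continuous_intros\<close>)
  then show ?thesis by simp
qed

lemma continuous_semiflow_continuous_orbit:
  assumes "continuous_semiflow \<Psi>"
  shows "continuous_on {0..} (\<lambda>t. \<Psi> t x)"
proof -
  have "continuous_on ({0..} \<times> UNIV) (\<lambda>(t, x). \<Psi> t x)"
    using assms by (simp add: continuous_semiflow_def)
  then have "continuous_on {0..} (\<lambda>t. case (t, x) of (t, x) \<Rightarrow> \<Psi> t x)"
    by (rule continuous_on_compose2) (auto intro!: continuous_intros)
  then show ?thesis by simp
qed

lemma continuous_semiflow_add:
  assumes "continuous_semiflow \<Psi>" and "s \<ge> 0" and "t \<ge> 0"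
  shows "\<Psi> (t + s) x = \<Psi> t (\<Psi> s x)"
  using assms by (simp add: continuous_semiflow_def)

theorem theorem2p7:
  fixes a b :: "real ^ 'n" and T \<delta> \<epsilon> :: real
  assumes "T > 0" and "\<delta> > 0"
    and "dist a b > 2 * \<delta>"
    and "0 < \<epsilon>" and "\<epsilon> < \<delta>"
  shows "\<not> (\<exists>\<Psi> :: real \<Rightarrow> real ^ 'n \<Rightarrow> real ^ 'n. continuous_semiflow \<Psi> \<and>
            \<Psi> T ` cball a \<delta> \<subseteq> ball b \<epsilon> \<and> \<Psi> T ` cball b \<delta> \<subseteq> ball a \<epsilon>)"
proof
  assume "\<exists>\<Psi> :: real \<Rightarrow> real ^ 'n \<Rightarrow> real ^ 'n. continuous_semiflow \<Psi> \<and>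
            \<Psi> T ` cball a \<delta> \<subseteq> ball b \<epsilon> \<and> \<Psi> T ` cball b \<delta> \<subseteq> ball a \<epsilon>"
  then obtain \<Psi> :: "real \<Rightarrow> real ^ 'n \<Rightarrow> real ^ 'n" where flow: "continuous_semiflow \<Psi>"
    and ab: "\<Psi> T ` cball a \<delta> \<subseteq> ball b \<epsilon>" and ba: "\<Psi> T ` cball b \<delta> \<subseteq> ball a \<epsilon>"
    by blast
  have sub: "ball c \<epsilon> \<subseteq> cball c \<delta>" for c :: "real ^ 'n"
    using \<open>\<epsilon> < \<delta>\<close> by auto
  have return: "\<Psi> (T + T) x \<in> ball a \<epsilon>" if "x \<in> cball a \<delta>" for x
  proof -
    have "\<Psi> T x \<in> cball b \<delta>"
      using ab sub that by blast
    then have "\<Psi> T (\<Psi> T x) \<in> ball a \<epsilon>"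
      using ba by blast
    then show ?thesis
      using continuous_semiflow_add[OF flow, of T T x] \<open>T > 0\<close> by simp
  qed
  have cont: "continuous_on (cball a \<delta>) (\<Psi> (T + T))"
    using continuous_semiflow_continuous_map[OF flow] \<open>T > 0\<close> by simp
  have self: "\<Psi> (T + T) \<in> cball a \<delta> \<rightarrow> cball a \<delta>"
    using return sub by blast
  obtain p where p: "p \<in> cball a \<delta>" "\<Psi> (T + T) p = p"
    using brouwer_ball[OF \<open>\<delta> > 0\<close> cont self] by blast
  \<comment> \<open>Both sides equal \<open>\<Psi> (t + (T + T)) p\<close>, since the times
    \<open>t\<close> and \<open>T + T\<close> may be applied in either order and \<open>p\<close> is
    fixed by the latter.\<close>
  have periodic: "\<Psi> (T + T) (\<Psi> t p) = \<Psi> t p" if "t \<ge> 0" for t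
    using that \<open>T > 0\<close> p(2) continuous_semiflow_add[OF flow, of t "T + T" p]
      continuous_semiflow_add[OF flow, of "T + T" t p]
    by (simp add: add.commute)
  define orbit where "orbit = (\<lambda>t. \<Psi> t p) ` {0..}"
  have "connected orbit"
    unfolding orbit_def
    by (intro connected_continuous_image continuous_semiflow_continuous_orbit[OF flow]) simp
  \<comment> \<open>Equivalently, the orbit misses the shell between the two radii: an orbit point
    in the closed ball is its own image in \<open>return\<close>.\<close>
  moreover have "orbit \<subseteq> ball a \<epsilon> \<union> - cball a \<delta>"
    unfolding orbit_def using return periodic by fastforce
  moreover have "ball a \<epsilon> \<inter> - cball a \<delta> \<inter> orbit = {}"
    using sub by blast
  \<comment> \<open>Both sets are open, so the connected orbit cannot meet both; \<open>p\<close>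
    and \<open>\<Psi> T p\<close> will be shown to lie one in each.\<close>
  ultimately have "ball a \<epsilon> \<inter> orbit = {} \<or> - cball a \<delta> \<inter> orbit = {}"
    by (intro connectedD) auto
  moreover have "p \<in> ball a \<epsilon> \<inter> orbit"
  proof -
    have "p = \<Psi> 0 p"
      using flow by (simp add: continuous_semiflow_def)
    then have "p \<in> orbit"
      unfolding orbit_def by force
    then show ?thesis
      using return[OF p(1)] p(2) by simp
  qed
  moreover have "\<Psi> T p \<in> - cball a \<delta> \<inter> orbit"
  proof -
    \<comment> \<open>A point within \<delta> of both centres would give
      \<open>dist a b \<le> 2 * \<delta>\<close>.\<close>
    have "dist b (\<Psi> T p) < \<delta>"
      using ab p(1) \<open>\<epsilon> < \<delta>\<close> by force
    then have "\<Psi> T p \<notin> cball a \<delta>"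
      using \<open>dist a b > 2 * \<delta>\<close> dist_triangle2[of a b "\<Psi> T p"] by auto
    then show ?thesis
      unfolding orbit_def using \<open>T > 0\<close> by auto
  qed
  ultimately show False
    by blast
qed

end
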